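(* Let $G$ be a finite group, let $\varphi$ be a faithful (not necessarily irreducible) character of $G$ and let $\psi\in\operatorname{Irr}(G)$. Suppose that $\varphi\psi=m\Delta$, where $m$ is a positive integer and $\Delta$ is a (not necessarily irreducible) character of $G$. If $\Delta(1)\leq\psi(1)$, then all three of $\varphi$, $\psi$ and $\Delta$ vanish on $G-\mathbf{Z}(G)$. If, in addition, $\varphi$ is irreducible, then $\varphi(1)=\psi(1)=\Delta(1)$.
   Context: All characters are complex characters of finite groups. $\operatorname{Irr}(G)$ is the set of irreducible characters of $G$, and $\mathbf{Z}(G)$ is the center of $G$. A character is faithful if its kernel $\{g\in G : \varphi(g)=\varphi(1)\}$ is trivial. *)

theory Defs
  imports "Jordan_Normal_Form.VS_Connect" "HOL-Library.FuncSet"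
begin

definition GL :: "nat \<Rightarrow> complex mat monoid" where
  "GL n = units_of (ring_mat TYPE(complex) n ())"

definition mtrace :: "complex mat \<Rightarrow> complex" where
  "mtrace A = (\<Sum>i<dim_row A. A $$ (i, i))"

(* The degree n is positive: the zero function is not counted as a character. *)
definition representation :: "('a, 'b) monoid_scheme \<Rightarrow> nat \<Rightarrow> ('a \<Rightarrow> complex mat) \<Rightarrow> bool" where
  "representation G n \<rho> \<longleftrightarrow> n > 0 \<and> \<rho> \<in> hom G (GL n)"

definition irreducible_representation ::
    "('a, 'b) monoid_scheme \<Rightarrow> nat \<Rightarrow> ('a \<Rightarrow> complex mat) \<Rightarrow> bool" where
  "irreducible_representation G n \<rho> \<longleftrightarrow>
     representation G n \<rho> \<and>
     (\<forall>W. VectorSpace.subspace class_ring W (module_vec TYPE(complex) n) \<and>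
          (\<forall>g\<in>carrier G. \<forall>w\<in>W. \<rho> g *\<^sub>v w \<in> W)
        \<longrightarrow> W = {0\<^sub>v n} \<or> W = carrier_vec n)"

(* Characters are extensional: their value outside the carrier is undefined,
   so equal characters are equal as HOL functions. *)
definition afforded :: "('a, 'b) monoid_scheme \<Rightarrow> ('a \<Rightarrow> complex mat) \<Rightarrow> 'a \<Rightarrow> complex" where
  "afforded G \<rho> = (\<lambda>g\<in>carrier G. mtrace (\<rho> g))"

definition characters :: "('a, 'b) monoid_scheme \<Rightarrow> ('a \<Rightarrow> complex) set" where
  "characters G = {afforded G \<rho> | n \<rho>. representation G n \<rho>}"

definition Irr :: "('a, 'b) monoid_scheme \<Rightarrow> ('a \<Rightarrow> complex) set" where
  "Irr G = {afforded G \<rho> | n \<rho>. irreducible_representation G n \<rho>}"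

definition char_kernel :: "('a, 'b) monoid_scheme \<Rightarrow> ('a \<Rightarrow> complex) \<Rightarrow> 'a set" where
  "char_kernel G \<chi> = {g \<in> carrier G. \<chi> g = \<chi> \<one>\<^bsub>G\<^esub>}"

definition faithful :: "('a, 'b) monoid_scheme \<Rightarrow> ('a \<Rightarrow> complex) \<Rightarrow> bool" where
  "faithful G \<chi> \<longleftrightarrow> char_kernel G \<chi> = {\<one>\<^bsub>G\<^esub>}"

definition center :: "('a, 'b) monoid_scheme \<Rightarrow> 'a set" where
  "center G = {z \<in> carrier G. \<forall>g\<in>carrier G. z \<otimes>\<^bsub>G\<^esub> g = g \<otimes>\<^bsub>G\<^esub> z}"

end

theory Submission
  imports Defs "Jordan_Normal_Form.Spectral_Radius" "HOL-Algebra.Multiplicative_Group"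
begin

text \<open>
  Degrees give \<open>\<phi>(1) \<le> m\<close>. As \<open>[\<Delta>,\<Delta>]\<close> is a positive integer and \<open>[\<psi>,\<psi>] = 1\<close>,
  the chain \<open>m\<^sup>2 \<le> m\<^sup>2 [\<Delta>,\<Delta>] = [\<phi>\<psi>,\<phi>\<psi>] \<le> \<phi>(1)\<^sup>2 [\<psi>,\<psi>] \<le> m\<^sup>2\<close> consists of equalities, so
  \<open>\<phi>(1) = m\<close> and \<open>|\<phi>(g)| = \<phi>(1)\<close> wherever \<open>\<psi>(g) \<noteq> 0\<close>. Such a \<open>g\<close> acts as a scalar and is
  central because \<open>\<phi>\<close> is faithful; hence \<open>\<psi>\<close> and \<open>\<Delta>\<close> vanish off the center.

  For \<open>\<phi>\<close>, let \<open>g\<close> be noncentral. By Schur's lemma the class sum of \<open>g\<close> acts in the representation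
  of \<open>\<psi>\<close> as a scalar, which is 0 since \<open>\<psi>(g) = 0\<close>; multiplying by \<open>g\<close> inverse and taking traces,
  \<open>\<psi>\<close> sums to 0 over the commutators \<open>[h,g]\<close>. So \<open>\<psi>([h,g]) \<noteq> 0\<close> for some \<open>[h,g] \<noteq> 1\<close>. This
  commutator acts in the representation of \<open>\<phi>\<close> as a scalar \<open>c \<noteq> 1\<close>, and conjugating \<open>g\<close> by \<open>h\<close>
  gives \<open>\<phi>(g) = c \<phi>(g)\<close>. Finally, an irreducible character \<open>\<chi>\<close> vanishing off the center satisfies
  \<open>\<chi>(1)\<^sup>2 = |G : Z(G)|\<close>.
\<close>

section \<open>Traces of complex matrices\<close>

lemma mtrace_mult:
  assumes "A \<in> carrier_mat n n" "B \<in> carrier_mat n n"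
  shows "mtrace (A * B) = (\<Sum>i<n. \<Sum>j<n. A $$ (i,j) * B $$ (j,i))"
  using assms by (auto simp: mtrace_def scalar_prod_def lessThan_atLeast0 intro!: sum.cong)

lemma mtrace_mult_comm:
  assumes "A \<in> carrier_mat n n" "B \<in> carrier_mat n n"
  shows "mtrace (A * B) = mtrace (B * A)"
  unfolding mtrace_mult[OF assms] mtrace_mult[OF assms(2,1)]
  by (subst sum.swap) (simp add: mult.commute)

lemma mtrace_similar:
  assumes "A \<in> carrier_mat n n" "similar_mat_wit A B P Q"
  shows "mtrace A = mtrace B"
proof -
  note * = similar_mat_witD2[OF assms]
  have "mtrace A = mtrace (P * (B * Q))" using * by (simp add: assoc_mult_mat)
  also have "\<dots> = mtrace (B * Q * P)" using * by (intro mtrace_mult_comm) auto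
  also have "B * Q * P = B" using * by (simp add: assoc_mult_mat[of B n n Q n P n])
  finally show ?thesis .
qed

lemma mtrace_smult: "mtrace (c \<cdot>\<^sub>m A) = c * mtrace A"
  if "A \<in> carrier_mat n n"
  using that by (auto simp: mtrace_def sum_distrib_left)

lemma mtrace_one: "mtrace (1\<^sub>m n) = of_nat n"
  by (simp add: mtrace_def)

section \<open>Triangular forms, idempotents and matrices of finite order\<close>

lemma triangularizable:
  fixes A :: "complex mat"
  assumes "A \<in> carrier_mat n n"
  obtains B P Q where "similar_mat_wit A B P Q" "upper_triangular B" "B \<in> carrier_mat n n"
proof -
  obtain es where "char_poly A = (\<Prod>a\<leftarrow>es. [:- a, 1:])"
    using char_poly_factorized[OF assms] by blast
  from schur_upper_triangular[OF assms this] that show ?thesis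
    unfolding similar_mat_def by blast
qed

text \<open>A factor of the summand vanishes by triangularity unless \<open>l\<close> lies between
  \<open>i\<close> and \<open>j\<close>; for \<open>i > j\<close> the interval is empty, so products
  stay triangular.\<close>

lemma upper_triangular_mult_entry:
  fixes A B :: "'a :: comm_ring_1 mat"
  assumes "A \<in> carrier_mat n n" "B \<in> carrier_mat n n" "upper_triangular A" "upper_triangular B"
    and "i < n" "j < n"
  shows "(A * B) $$ (i,j) = (\<Sum>l\<in>{i..j}. A $$ (i,l) * B $$ (l,j))"
proof -
  have "(A * B) $$ (i,j) = (\<Sum>l<n. A $$ (i,l) * B $$ (l,j))"
    using assms by (auto simp: scalar_prod_def lessThan_atLeast0 intro!: sum.cong)
  also have "\<dots> = (\<Sum>l\<in>{i..j}. A $$ (i,l) * B $$ (l,j))"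
  proof (rule sum.mono_neutral_right)
    have "A $$ (i,l) * B $$ (l,j) = 0" if "l < n" "l < i \<or> j < l" for l
      using that upper_triangularD[OF assms(3), of l i] upper_triangularD[OF assms(4), of j l] assms
      by auto
    then show "\<forall>l\<in>{..<n} - {i..j}. A $$ (i,l) * B $$ (l,j) = 0" by auto
  qed (use assms in auto)
  finally show ?thesis .
qed

lemma upper_triangular_pow:
  fixes A :: "'a :: comm_ring_1 mat"
  assumes "A \<in> carrier_mat n n" "upper_triangular A"
  shows "upper_triangular (A ^\<^sub>m k)" and "i < n \<Longrightarrow> (A ^\<^sub>m k) $$ (i,i) = A $$ (i,i) ^ k"
proof -
  have "upper_triangular (A ^\<^sub>m k) \<and> (\<forall>i<n. (A ^\<^sub>m k) $$ (i,i) = A $$ (i,i) ^ k)"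
  proof (induction k)
    case 0
    then show ?case using assms by (auto simp: upper_triangular_def)
  next
    case (Suc k)
    have c: "A ^\<^sub>m k \<in> carrier_mat n n" using assms by simp
    show ?case
      using upper_triangular_mult_entry[OF c assms(1) _ assms(2)] Suc c assms
      by (auto simp: upper_triangular_def)
  qed
  then show "upper_triangular (A ^\<^sub>m k)" and "i < n \<Longrightarrow> (A ^\<^sub>m k) $$ (i,i) = A $$ (i,i) ^ k"
    by auto
qed

text \<open>A triangular form of an idempotent is idempotent, so its diagonal consists of zeros and
  ones and the trace counts the ones. This is the source of all integrality below.\<close>

lemma idempotent_trace:
  fixes A :: "complex mat"
  assumes A: "A \<in> carrier_mat n n" and idem: "A * A = A"
  obtains r :: nat where "mtrace A = of_nat r"
proof -
  obtain B P Q where B: "similar_mat_wit A B P Q" "upper_triangular B" "B \<in> carrier_mat n n"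
    using triangularizable[OF A] .
  note * = similar_mat_witD2[OF A B(1)]
  have "B ^\<^sub>m 2 = B"
  proof -
    have "similar_mat_wit (B ^\<^sub>m 2) (A ^\<^sub>m 2) Q P"
      by (rule similar_mat_wit_pow[OF similar_mat_wit_sym[OF B(1)]])
    then have "B ^\<^sub>m 2 = Q * A ^\<^sub>m 2 * P" unfolding similar_mat_wit_def Let_def by blast
    moreover have "B = Q * A * P"
      using similar_mat_wit_sym[OF B(1)] unfolding similar_mat_wit_def Let_def by blast
    ultimately show ?thesis using idem A by (simp add: numeral_2_eq_2)
  qed
  then have d: "B $$ (i,i) ^ 2 = B $$ (i,i)" if "i < n" for i
    using upper_triangular_pow(2)[OF B(3,2) that, of 2] by simp
  have "\<exists>r::nat. B $$ (i,i) = of_nat r" if "i < n" for i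
  proof -
    have "B $$ (i,i) = 0 \<or> B $$ (i,i) = 1" using d[OF that] by (simp add: power2_eq_square)
    then show ?thesis by (metis of_nat_0 of_nat_1)
  qed
  then obtain r where r: "\<And>i. i < n \<Longrightarrow> B $$ (i,i) = of_nat (r i)" by metis
  have "mtrace A = of_nat (\<Sum>i<n. r i)"
    unfolding mtrace_similar[OF A B(1)] unfolding mtrace_def of_nat_sum
    using B(3) r by (intro sum.cong) auto
  with that show ?thesis .
qed

text \<open>In characteristic zero a matrix of finite order has no nontrivial Jordan block. This
  takes the place of diagonalizability: equal eigenvalues already force a scalar matrix.\<close>

lemma upper_triangular_pow_eq_one:
  fixes B :: "complex mat"
  assumes B: "B \<in> carrier_mat n n" "upper_triangular B"
    and k: "k > 0" "B ^\<^sub>m k = 1\<^sub>m n" and diag: "\<And>i. i < n \<Longrightarrow> B $$ (i,i) = u"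
  shows "B = u \<cdot>\<^sub>m 1\<^sub>m n"
\<comment> \<open>The entry at (0,0) is needed to see that \<open>u\<close> is nonzero.\<close>
proof (cases "n = 0")
  case True
  then show ?thesis using B by auto
next
  case False
  have "u ^ k = 1" using upper_triangular_pow(2)[OF B, of 0 k] False diag k by auto
  then have u: "u \<noteq> 0" using k by (auto simp: power_0_left)
  text \<open>
    The first nonzero superdiagonal of \<open>B\<close> would be multiplied by \<open>p u\<^bsup>p-1\<^esup>\<close> in \<open>B\<^bsup>p\<^esup>\<close>; the extra
    factor \<open>u\<close> below avoids the truncated exponent \<open>p - 1\<close>.
  \<close>
  have off: "B $$ (i, j) = 0" if "i < j" "j < n" for i j
    using that
  proof (induction "j - i" arbitrary: i j rule: less_induct)
    case less
    have IH: "B $$ (i',j') = 0" if "i' < j'" "j' < n" "j' - i' < j - i" for i' j'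
      using less(1)[of j' i'] that by simp
    have "(\<forall>i' j'. i' < j' \<and> j' < n \<and> j' - i' < j - i \<longrightarrow> (B ^\<^sub>m p) $$ (i',j') = 0) \<and>
        u * (B ^\<^sub>m p) $$ (i,j) = of_nat p * u ^ p * B $$ (i,j)" for p
    proof (induction p)
      case 0
      then show ?case using B less by auto
    next
      case (Suc p)
      have C: "B ^\<^sub>m p \<in> carrier_mat n n" "upper_triangular (B ^\<^sub>m p)"
        using B upper_triangular_pow by auto
      \<comment> \<open>For \<open>l\<close> strictly between \<open>i'\<close> and
        \<open>j'\<close>, the entry of \<open>B\<close> at \<open>(l,j')\<close> lies on a
        superdiagonal closer to the diagonal, which is zero by induction; only the two end terms
        survive.\<close>
      have e: "(B ^\<^sub>m Suc p) $$ (i',j') = (B ^\<^sub>m p) $$ (i',i') * B $$ (i',j') + (B ^\<^sub>m p) $$ (i',j') * B $$ (j',j')"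
        if "i' < j'" "j' < n" "j' - i' \<le> j - i" for i' j'
      proof -
        have "(B ^\<^sub>m Suc p) $$ (i',j') = (\<Sum>l\<in>{i'..j'}. (B ^\<^sub>m p) $$ (i',l) * B $$ (l,j'))"
          using upper_triangular_mult_entry[OF C(1) B(1) C(2) B(2), of i' j'] that by simp
        also have "\<dots> = (\<Sum>l\<in>{i',j'}. (B ^\<^sub>m p) $$ (i',l) * B $$ (l,j'))"
          using that by (intro sum.mono_neutral_right) (auto simp: IH)
        finally show ?thesis using that by simp
      qed
      show ?case
      proof
        show "\<forall>i' j'. i' < j' \<and> j' < n \<and> j' - i' < j - i \<longrightarrow> (B ^\<^sub>m Suc p) $$ (i',j') = 0"
          using Suc e IH by (simp del: pow_mat.simps)
        have "u * (B ^\<^sub>m Suc p) $$ (i,j) = u * (u ^ p * B $$ (i,j)) + u * (B ^\<^sub>m p) $$ (i,j) * u"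
          using e[of i j] less diag upper_triangular_pow(2)[OF B, of i p]
          by (simp del: pow_mat.simps add: algebra_simps)
        with Suc show "u * (B ^\<^sub>m Suc p) $$ (i,j) = of_nat (Suc p) * u ^ Suc p * B $$ (i,j)"
          by (simp del: pow_mat.simps add: algebra_simps)
      qed
    qed
    \<comment> \<open>For \<open>p = k\<close> the left side is an off-diagonal entry of the
      identity, hence 0, while \<open>k\<close> and \<open>u\<close> are nonzero.\<close>
    from conjunct2[OF this[of k]] k less u show ?case by simp
  qed
  show ?thesis
  proof (rule eq_matI)
    fix i j assume "i < dim_row (u \<cdot>\<^sub>m 1\<^sub>m n)" "j < dim_col (u \<cdot>\<^sub>m 1\<^sub>m n)"
    then have "i < n" "j < n" by auto
    then show "B $$ (i,j) = (u \<cdot>\<^sub>m 1\<^sub>m n) $$ (i,j)"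
      using off[of i j] diag[of i] upper_triangularD[OF B(2), of j i] B(1)
      by (cases i j rule: linorder_cases) auto
  qed (use B in auto)
qed

text \<open>\<open>b\<close> is the diagonal of a triangular form of \<open>A\<close>. A scalar
  triangular form is unchanged by conjugation, which gives the last property.\<close>

lemma finite_order_eigenvalues:
  fixes A :: "complex mat"
  assumes A: "A \<in> carrier_mat n n" and k: "k > 0" "A ^\<^sub>m k = 1\<^sub>m n"
  obtains b where "\<And>i. i < n \<Longrightarrow> b i ^ k = 1" "\<And>j. mtrace (A ^\<^sub>m j) = (\<Sum>i<n. b i ^ j)"
    "\<And>u. (\<And>i. i < n \<Longrightarrow> b i = u) \<Longrightarrow> A = u \<cdot>\<^sub>m 1\<^sub>m n"
proof -
  obtain B P Q where B: "similar_mat_wit A B P Q" "upper_triangular B" "B \<in> carrier_mat n n"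
    using triangularizable[OF A] .
  note * = similar_mat_witD2[OF A B(1)]
  have Bk: "B ^\<^sub>m k = 1\<^sub>m n"
  proof -
    have "similar_mat_wit (B ^\<^sub>m k) (A ^\<^sub>m k) Q P"
      by (rule similar_mat_wit_pow[OF similar_mat_wit_sym[OF B(1)]])
    then have "B ^\<^sub>m k = Q * A ^\<^sub>m k * P" unfolding similar_mat_wit_def Let_def by blast
    then show ?thesis using k * by simp
  qed
  show ?thesis
  proof (rule that[of "\<lambda>i. B $$ (i,i)"])
    show "B $$ (i,i) ^ k = 1" if "i < n" for i
      using upper_triangular_pow(2)[OF B(3,2) that, of k] Bk that by simp
    show "mtrace (A ^\<^sub>m j) = (\<Sum>i<n. B $$ (i,i) ^ j)" for j
    proof -
      have "mtrace (A ^\<^sub>m j) = mtrace (B ^\<^sub>m j)"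
        using A by (intro mtrace_similar[OF _ similar_mat_wit_pow[OF B(1)], of _ n]) simp
      also have "\<dots> = (\<Sum>i<n. B $$ (i,i) ^ j)"
        using B by (auto simp: mtrace_def upper_triangular_pow(2) intro!: sum.cong)
      finally show ?thesis .
    qed
    show "A = u \<cdot>\<^sub>m 1\<^sub>m n" if "\<And>i. i < n \<Longrightarrow> B $$ (i,i) = u" for u
    proof -
      have "B = u \<cdot>\<^sub>m 1\<^sub>m n" using upper_triangular_pow_eq_one[OF B(3,2) k(1) Bk that] .
      then have "A = P * (u \<cdot>\<^sub>m 1\<^sub>m n) * Q" using * by simp
      also have "\<dots> = u \<cdot>\<^sub>m (P * 1\<^sub>m n * Q)"
        using * by (simp add: mult_smult_distrib[of _ n n _ n] mult_smult_assoc_mat[of _ n n _ n])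
      finally show ?thesis using * by simp
    qed
  qed
qed

text \<open>The trace is a sum of \<open>n\<close> roots of unity. The triangle inequality bounds
  it, equality forces all of them to coincide, and the power \<open>k - 1\<close> inverts each, that
  is, conjugates it.\<close>

lemma finite_order_trace_norm:
  assumes A: "A \<in> carrier_mat n n" and k: "k > 0" "A ^\<^sub>m k = 1\<^sub>m n"
  shows "cmod (mtrace A) \<le> real n"
    and "cmod (mtrace A) = real n \<Longrightarrow> n > 0 \<Longrightarrow> A = (mtrace A / of_nat n) \<cdot>\<^sub>m 1\<^sub>m n"
    and "mtrace (A ^\<^sub>m (k - 1)) = cnj (mtrace A)"
proof -
  obtain b where b: "\<And>i. i < n \<Longrightarrow> b i ^ k = 1" "\<And>j. mtrace (A ^\<^sub>m j) = (\<Sum>i<n. b i ^ j)"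
    "\<And>u. (\<And>i. i < n \<Longrightarrow> b i = u) \<Longrightarrow> A = u \<cdot>\<^sub>m 1\<^sub>m n"
    using finite_order_eigenvalues[OF A k] by blast
  have tr: "mtrace A = (\<Sum>i<n. b i)" using b(2)[of 1] A by simp
  have nb: "cmod (b i) = 1" if "i < n" for i
  proof (rule power_eq_imp_eq_base[of _ k])
    show "cmod (b i) ^ k = 1 ^ k" using b(1)[OF that] by (simp flip: norm_power)
  qed (use k in auto)
  show "cmod (mtrace A) \<le> real n"
    unfolding tr using sum_norm_le[of "{..<n}" b "\<lambda>_. 1"] nb by simp
  have "b i ^ (k - 1) = cnj (b i)" if "i < n" for i
  proof -
    have "b i * b i ^ (k - 1) = 1" using b(1)[OF that] k(1) by (cases k) auto
    moreover have "b i * cnj (b i) = 1"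
      using nb[OF that] by (simp add: complex_norm_square[symmetric])
    moreover have "b i \<noteq> 0" using nb[OF that] by auto
    ultimately show ?thesis by (metis mult_cancel_left)
  qed
  then show "mtrace (A ^\<^sub>m (k - 1)) = cnj (mtrace A)"
    by (simp add: b(2) tr)
  assume eq: "cmod (mtrace A) = real n" and n: "n > 0"
  \<comment> \<open>\<open>u\<close> is the mean of the eigenvalues, here of modulus 1. The numbers
    \<open>cnj u * b i\<close> have real part at most 1 and sum to \<open>n\<close>, so each real
    part is exactly 1; having modulus 1, they are all equal to 1.\<close>
  define u where "u = mtrace A / of_nat n"
  have nu: "cmod u = 1" using eq n by (simp add: u_def norm_divide)
  then have uu: "u * cnj u = 1" by (simp add: complex_norm_square[symmetric])
  have le: "Re (cnj u * b i) \<le> 1" if "i < n" for i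
    using complex_Re_le_cmod[of "cnj u * b i"] nb[OF that] nu by (simp add: norm_mult)
  have "(\<Sum>i<n. cnj u * b i) = cnj u * (of_nat n * u)"
    unfolding sum_distrib_left[symmetric] tr[symmetric] using n by (simp add: u_def)
  also have "\<dots> = of_nat n" using uu by (metis mult.assoc mult.commute mult_1_right)
  finally have "(\<Sum>i<n. cnj u * b i) = of_nat n" .
  then have "(\<Sum>i<n. Re (cnj u * b i)) = real n"
    by (metis Re_sum complex_Re_of_nat)
  then have "(\<Sum>i<n. 1 - Re (cnj u * b i)) = 0" by (simp add: sum_subtractf)
  then have re: "Re (cnj u * b i) = 1" if "i < n" for i
    using le that by (subst (asm) sum_nonneg_eq_0_iff) auto
  have "b i = u" if "i < n" for i
  proof -
    have "cmod (cnj u * b i) = 1" using nb[OF that] nu by (simp add: norm_mult)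
    then have "Im (cnj u * b i) = 0"
      using re[OF that] cmod_power2[of "cnj u * b i"] by simp
    with re[OF that] have 1: "cnj u * b i = 1" by (intro complex_eqI) auto
    have "b i = u * (cnj u * b i)" using uu by (simp flip: mult.assoc)
    with 1 show ?thesis by simp
  qed
  then show "A = (mtrace A / of_nat n) \<cdot>\<^sub>m 1\<^sub>m n" using b(3) by (simp add: u_def)
qed

section \<open>Kronecker products and complex conjugation of matrices\<close>

lemma sum_div_mod:
  fixes f :: "nat \<Rightarrow> nat \<Rightarrow> 'a :: comm_monoid_add"
  shows "(\<Sum>r<n*n. f (r div n) (r mod n)) = (\<Sum>i<n. \<Sum>j<n. f i j)"
proof -
  have "(\<Sum>r<n*n. f (r div n) (r mod n)) = (\<Sum>(i,j)\<in>{..<n}\<times>{..<n}. f i j)"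
  proof (rule sum.reindex_bij_witness[where i = "\<lambda>(i,j). i * n + j" and j = "\<lambda>r. (r div n, r mod n)"])
    fix r assume "r \<in> {..<n*n}"
    then have "r < n * n" "n > 0" by (auto intro: Nat.gr0I)
    then show "(r div n, r mod n) \<in> {..<n} \<times> {..<n}"
      by (auto simp: less_mult_imp_div_less)
  next
    fix p assume "p \<in> {..<n} \<times> {..<n}"
    then obtain i j where p: "p = (i,j)" "i < n" "j < n" by auto
    have "i * n + j < Suc i * n" using p by simp
    also have "\<dots> \<le> n * n" using p by (intro mult_right_mono) auto
    finally show "(case p of (i,j) \<Rightarrow> i * n + j) \<in> {..<n*n}" using p by simp
  qed (auto split: prod.splits)
  then show ?thesis by (simp add: sum.cartesian_product)
qed

text \<open>The Kronecker product of square matrices of the same size: the index pair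
  \<open>(i,j)\<close> is coded as the number \<open>i * n + j\<close>.\<close>

definition kron :: "nat \<Rightarrow> 'a :: comm_ring_1 mat \<Rightarrow> 'a mat \<Rightarrow> 'a mat" where
  "kron n A B = mat (n * n) (n * n)
     (\<lambda>(r,s). A $$ (r div n, s div n) * B $$ (r mod n, s mod n))"

lemma kron_carrier [simp]: "kron n A B \<in> carrier_mat (n * n) (n * n)"
  by (simp add: kron_def)

lemma kron_mult:
  assumes [simp]: "A \<in> carrier_mat n n" "B \<in> carrier_mat n n" "C \<in> carrier_mat n n" "D \<in> carrier_mat n n"
  shows "kron n A B * kron n C D = kron n (A * C) (B * D)"
proof (rule eq_matI)
  fix r s assume "r < dim_row (kron n (A * C) (B * D))" "s < dim_col (kron n (A * C) (B * D))"
  then have rs: "r < n * n" "s < n * n" by (auto simp: kron_def)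
  then have "n > 0" by (auto intro: Nat.gr0I)
  with rs have d: "r div n < n" "s div n < n" "r mod n < n" "s mod n < n"
    by (auto simp: less_mult_imp_div_less)
  have entry: "(X * Y) $$ (i,j) = (\<Sum>l<n. X $$ (i,l) * Y $$ (l,j))"
    if "X \<in> carrier_mat n n" "Y \<in> carrier_mat n n" "i < n" "j < n" for X Y :: "'a mat" and i j
    using that by (auto simp: scalar_prod_def lessThan_atLeast0 intro!: sum.cong)
  let ?f = "\<lambda>i j. A $$ (r div n, i) * B $$ (r mod n, j) * (C $$ (i, s div n) * D $$ (j, s mod n))"
  have "(kron n A B * kron n C D) $$ (r,s) = (\<Sum>t<n*n. ?f (t div n) (t mod n))"
    using rs by (auto simp: kron_def scalar_prod_def lessThan_atLeast0 intro!: sum.cong)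
  also have "\<dots> = (\<Sum>i<n. \<Sum>j<n. ?f i j)" by (rule sum_div_mod)
  also have "\<dots> = (\<Sum>i<n. A $$ (r div n, i) * C $$ (i, s div n)) * (\<Sum>j<n. B $$ (r mod n, j) * D $$ (j, s mod n))"
    unfolding sum_product by (intro sum.cong refl) (simp add: algebra_simps)
  also have "\<dots> = kron n (A * C) (B * D) $$ (r,s)"
    using rs d by (simp add: kron_def entry del: index_mult_mat)
  finally show "(kron n A B * kron n C D) $$ (r,s) = kron n (A * C) (B * D) $$ (r,s)" .
qed (auto simp: kron_def)

lemma mtrace_kron:
  assumes "A \<in> carrier_mat n n" "B \<in> carrier_mat n n"
  shows "mtrace (kron n A B) = mtrace A * mtrace B"
proof -
  have "mtrace (kron n A B) = (\<Sum>t<n*n. A $$ (t div n, t div n) * B $$ (t mod n, t mod n))"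
    by (auto simp: mtrace_def kron_def)
  also have "\<dots> = (\<Sum>i<n. \<Sum>j<n. A $$ (i,i) * B $$ (j,j))"
    by (rule sum_div_mod)
  also have "\<dots> = mtrace A * mtrace B"
    unfolding mtrace_def sum_product using assms by simp
  finally show ?thesis .
qed

lemma kron_one: "kron n (1\<^sub>m n) (1\<^sub>m n) = 1\<^sub>m (n * n)"
proof (rule eq_matI)
  fix r s assume "r < dim_row (1\<^sub>m (n * n))" "s < dim_col (1\<^sub>m (n * n))"
  then have rs: "r < n * n" "s < n * n" by auto
  then have "n > 0" by (auto intro: Nat.gr0I)
  with rs have "r div n < n" "s div n < n" "r mod n < n" "s mod n < n"
    by (auto simp: less_mult_imp_div_less)
  moreover have "r = s \<longleftrightarrow> r div n = s div n \<and> r mod n = s mod n"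
    by (metis div_mult_mod_eq)
  ultimately show "kron n (1\<^sub>m n) (1\<^sub>m n) $$ (r,s) = 1\<^sub>m (n * n) $$ (r,s)"
    using rs by (auto simp: kron_def)
qed (auto simp: kron_def)

lemma map_mat_cnj_mult:
  assumes "A \<in> carrier_mat n n" "B \<in> carrier_mat n n"
  shows "map_mat cnj (A * B) = map_mat cnj A * map_mat cnj B"
  using assms by (intro eq_matI) (auto simp: scalar_prod_def)

lemma mtrace_cnj: "A \<in> carrier_mat n n \<Longrightarrow> mtrace (map_mat cnj A) = cnj (mtrace A)"
  by (simp add: mtrace_def)

section \<open>Characters of matrix representations\<close>

locale matrix_rep = group G for G :: "('a, 'b) monoid_scheme" (structure) +
  fixes n :: nat and \<rho> :: "'a \<Rightarrow> complex mat"
  assumes fin: "finite (carrier G)" and degree_pos: "n > 0"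
    and closed [simp]: "g \<in> carrier G \<Longrightarrow> \<rho> g \<in> carrier_mat n n"
    and rho_mult: "g \<in> carrier G \<Longrightarrow> h \<in> carrier G \<Longrightarrow> \<rho> (g \<otimes> h) = \<rho> g * \<rho> h"
    and rho_one: "\<rho> \<one> = 1\<^sub>m n"
begin

abbreviation \<chi> :: "'a \<Rightarrow> complex" where "\<chi> g \<equiv> mtrace (\<rho> g)"

lemma dim_rho [simp]: "g \<in> carrier G \<Longrightarrow> dim_row (\<rho> g) = n" "g \<in> carrier G \<Longrightarrow> dim_col (\<rho> g) = n"
  using closed by blast+

lemma rho_mult_entry:
  assumes "g \<in> carrier G" "h \<in> carrier G" "i < n" "j < n"
  shows "\<rho> (g \<otimes> h) $$ (i,j) = (\<Sum>l<n. \<rho> g $$ (i,l) * \<rho> h $$ (l,j))"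
  using assms by (auto simp: rho_mult scalar_prod_def lessThan_atLeast0 intro!: sum.cong)

lemma rho_pow: "g \<in> carrier G \<Longrightarrow> \<rho> (g [^] k) = \<rho> g ^\<^sub>m (k::nat)"
  by (induction k) (auto simp: rho_one rho_mult)

lemma order_pos: "Coset.order G > 0"
  using fin order_gt_0_iff_finite by blast

lemma rho_pow_order: "g \<in> carrier G \<Longrightarrow> \<rho> g ^\<^sub>m Coset.order G = 1\<^sub>m n"
  by (metis pow_order_eq_1 rho_one rho_pow)

lemma char_one: "\<chi> \<one> = of_nat n"
  by (simp add: rho_one mtrace_one)

lemma norm_char_le: "g \<in> carrier G \<Longrightarrow> cmod (\<chi> g) \<le> real n"
  using finite_order_trace_norm(1)[OF closed order_pos rho_pow_order] .

lemma rho_scalar: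
  "g \<in> carrier G \<Longrightarrow> cmod (\<chi> g) = real n \<Longrightarrow> \<rho> g = (\<chi> g / of_nat n) \<cdot>\<^sub>m 1\<^sub>m n"
  using finite_order_trace_norm(2)[OF closed order_pos rho_pow_order] degree_pos by blast

lemma char_inv:
  assumes g: "g \<in> carrier G"
  shows "\<chi> (inv g) = cnj (\<chi> g)"
proof -
  have "g \<otimes> g [^] (Coset.order G - 1) = \<one>"
    using order_pos g pow_order_eq_1[OF g] nat_pow_Suc2[OF g, of "Coset.order G - 1"] by simp
  then have "inv g = g [^] (Coset.order G - 1)"
    using g by (metis inv_comm inv_equality nat_pow_closed)
  then show ?thesis
    using finite_order_trace_norm(3)[OF closed[OF g] order_pos rho_pow_order[OF g]] rho_pow[OF g] by simp
qed

lemma char_conj: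
  assumes "g \<in> carrier G" "h \<in> carrier G"
  shows "\<chi> (h \<otimes> g \<otimes> inv h) = \<chi> g"
proof -
  have "\<chi> (h \<otimes> g \<otimes> inv h) = \<chi> (inv h \<otimes> (h \<otimes> g))"
    using assms mtrace_mult_comm[OF closed closed, of "h \<otimes> g" "inv h"]
    by (simp add: rho_mult[of "h \<otimes> g" "inv h"] rho_mult[of "inv h" "h \<otimes> g"])
  then show ?thesis using assms by (simp flip: m_assoc)
qed

lemma sum_translate:
  assumes "x \<in> carrier G"
  shows "(\<Sum>g\<in>carrier G. f (x \<otimes> g)) = (\<Sum>g\<in>carrier G. f g)"
  using sum.reindex[OF inj_on_cmult[OF assms], of f] surj_const_mult[OF assms] by simp

text \<open>The average \<open>E\<close> of the representing matrices is the projection onto the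
  fixed vectors; its trace \<open>r\<close> is the multiplicity of the trivial character.\<close>

lemma sum_char_nat:
  obtains r :: nat where "(\<Sum>g\<in>carrier G. \<chi> g) = of_nat (r * Coset.order G)"
proof -
  define N :: complex where "N = of_nat (Coset.order G)"
  have N: "N \<noteq> 0" using order_pos by (simp add: N_def)
  define E where "E = mat n n (\<lambda>(i,j). (\<Sum>g\<in>carrier G. \<rho> g $$ (i,j)) / N)"
  have E: "E \<in> carrier_mat n n" by (simp add: E_def)
  have "E * E = E"
  proof (rule eq_matI)
    fix i j assume "i < dim_row E" "j < dim_col E"
    then have ij: "i < n" "j < n" using E by auto
    have "(E * E) $$ (i,j) = (\<Sum>l<n. E $$ (i,l) * E $$ (l,j))"
      using ij E by (auto simp: scalar_prod_def lessThan_atLeast0 intro!: sum.cong)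
    also have "\<dots> = (\<Sum>l<n. \<Sum>g\<in>carrier G. \<Sum>h\<in>carrier G. \<rho> g $$ (i,l) * \<rho> h $$ (l,j)) / (N * N)"
      using ij by (simp add: E_def sum_product sum_divide_distrib)
    also have "(\<Sum>l<n. \<Sum>g\<in>carrier G. \<Sum>h\<in>carrier G. \<rho> g $$ (i,l) * \<rho> h $$ (l,j)) =
        (\<Sum>g\<in>carrier G. \<Sum>h\<in>carrier G. \<Sum>l<n. \<rho> g $$ (i,l) * \<rho> h $$ (l,j))"
      by (subst sum.swap, rule sum.cong[OF refl], subst sum.swap, rule refl)
    also have "\<dots> = (\<Sum>g\<in>carrier G. \<Sum>h\<in>carrier G. \<rho> (g \<otimes> h) $$ (i,j))"
      using ij by (simp add: rho_mult_entry)
    \<comment> \<open>For each fixed \<open>g\<close> the inner sum over \<open>h\<close> is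
      invariant under translation by \<open>g\<close>.\<close>
    also have "\<dots> = N * (\<Sum>h\<in>carrier G. \<rho> h $$ (i,j))"
      by (simp add: sum_translate[where f = "\<lambda>g. \<rho> g $$ (i,j)"] N_def Coset.order_def)
    finally show "(E * E) $$ (i,j) = E $$ (i,j)"
      using ij N by (simp add: E_def)
  qed (use E in auto)
  then obtain r :: nat where r: "mtrace E = of_nat r"
    using idempotent_trace[OF E] by blast
  have "mtrace E = (\<Sum>i<n. \<Sum>g\<in>carrier G. \<rho> g $$ (i,i)) / N"
    by (simp add: mtrace_def E_def sum_divide_distrib)
  also have "(\<Sum>i<n. \<Sum>g\<in>carrier G. \<rho> g $$ (i,i)) = (\<Sum>g\<in>carrier G. \<chi> g)"
    by (subst sum.swap) (simp add: mtrace_def)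
  finally show ?thesis using r N that[of r] by (simp add: N_def field_simps)
qed

text \<open>This representation affords the squared modulus of \<open>\<chi>\<close>, so its
  fixed-space multiplicity is the norm of \<open>\<chi>\<close>.\<close>

lemma kron_cnj_rep: "matrix_rep G (n * n) (\<lambda>g. kron n (\<rho> g) (map_mat cnj (\<rho> g)))"
proof unfold_locales
  have "map_mat cnj (1\<^sub>m n) = 1\<^sub>m n" by (intro eq_matI) auto
  then show "kron n (\<rho> \<one>) (map_mat cnj (\<rho> \<one>)) = 1\<^sub>m (n * n)"
    by (simp add: rho_one kron_one)
qed (use fin degree_pos in \<open>auto simp: rho_mult kron_mult map_mat_cnj_mult[of _ n]\<close>)

text \<open>The sum is a natural multiple of the group order, and the term at the identity makes it
  positive.\<close>

lemma sum_norm_char_ge: "(\<Sum>g\<in>carrier G. (cmod (\<chi> g))\<^sup>2) \<ge> real (Coset.order G)"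
proof -
  interpret K: matrix_rep G "n * n" "\<lambda>g. kron n (\<rho> g) (map_mat cnj (\<rho> g))"
    by (rule kron_cnj_rep)
  obtain r :: nat where "(\<Sum>g\<in>carrier G. K.\<chi> g) = of_nat (r * Coset.order G)"
    using K.sum_char_nat .
  moreover have "K.\<chi> g = of_real ((cmod (\<chi> g))\<^sup>2)" if "g \<in> carrier G" for g
    using that by (simp add: mtrace_kron[of _ n] mtrace_cnj[of _ n] complex_norm_square del: of_real_power)
  ultimately have "of_real (\<Sum>g\<in>carrier G. (cmod (\<chi> g))\<^sup>2) = (of_nat (r * Coset.order G) :: complex)"
    by simp
  then have r: "(\<Sum>g\<in>carrier G. (cmod (\<chi> g))\<^sup>2) = real (r * Coset.order G)"
    by (metis of_real_eq_iff of_real_of_nat_eq)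
  have "0 < (cmod (\<chi> \<one>))\<^sup>2" using degree_pos by (simp add: char_one)
  also have "\<dots> \<le> (\<Sum>g\<in>carrier G. (cmod (\<chi> g))\<^sup>2)"
    using fin by (intro member_le_sum) auto
  finally have "r \<ge> 1" unfolding r by (cases r) auto
  then show ?thesis
    unfolding r using mult_right_mono[of 1 "real r" "real (Coset.order G)"] by simp
qed

end

section \<open>Irreducible representations: Schur's lemma and its consequences\<close>

locale irreducible_matrix_rep = matrix_rep +
  assumes irreducible: "irreducible_representation G n \<rho>"
begin

text \<open>An eigenspace of \<open>T\<close> is nonzero and invariant, hence the whole space. The
  scalar is then recovered from the trace.\<close>

lemma schur:
  assumes T: "T \<in> carrier_mat n n"
    and comm: "\<And>g. g \<in> carrier G \<Longrightarrow> T * \<rho> g = \<rho> g * T"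
  shows "T = (mtrace T / of_nat n) \<cdot>\<^sub>m 1\<^sub>m n"
proof -
  obtain c v where v: "v \<in> carrier_vec n" "v \<noteq> 0\<^sub>v n" "T *\<^sub>v v = c \<cdot>\<^sub>v v"
    using spectrum_non_empty[OF T degree_pos] T
    unfolding spectrum_def eigenvalue_def eigenvector_def by auto
  define W where "W = {w \<in> carrier_vec n. T *\<^sub>v w = c \<cdot>\<^sub>v w}"
  have "VectorSpace.subspace class_ring W (module_vec TYPE(complex) n)"
  proof (intro VectorSpace.subspace.intro LinearCombinations.submodule.intro vec_vs vec_module)
    show "W \<subseteq> carrier (module_vec TYPE(complex) n)" by (auto simp: W_def module_vec_simps)
    show "\<zero>\<^bsub>module_vec TYPE(complex) n\<^esub> \<in> W"
      using T by (auto simp: W_def module_vec_simps)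
    show "v \<oplus>\<^bsub>module_vec TYPE(complex) n\<^esub> w \<in> W" if "v \<in> W" "w \<in> W" for v w
      using that T by (auto simp: W_def module_vec_simps mult_add_distrib_mat_vec[OF T] smult_add_distrib_vec)
    show "a \<odot>\<^bsub>module_vec TYPE(complex) n\<^esub> w \<in> W" if "w \<in> W" for a w
      using that T by (auto simp: W_def module_vec_simps mult_mat_vec[OF T] smult_smult_assoc mult.commute)
  qed
  moreover have "\<rho> g *\<^sub>v w \<in> W" if g: "g \<in> carrier G" and w: "w \<in> W" for g w
  proof -
    have w': "w \<in> carrier_vec n" "T *\<^sub>v w = c \<cdot>\<^sub>v w" using w by (auto simp: W_def)
    have "T *\<^sub>v (\<rho> g *\<^sub>v w) = \<rho> g *\<^sub>v (T *\<^sub>v w)"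
      using w' g T comm[OF g] by (metis assoc_mult_mat_vec closed)
    also have "\<dots> = c \<cdot>\<^sub>v (\<rho> g *\<^sub>v w)" using w' g by (simp add: mult_mat_vec[of _ n n])
    finally show ?thesis using w' closed[OF g] by (auto simp: W_def intro: mult_mat_vec_carrier)
  qed
  moreover have "W \<noteq> {0\<^sub>v n}" using v by (auto simp: W_def)
  ultimately have W: "W = carrier_vec n"
    using irreducible unfolding irreducible_representation_def by blast
  have "T = c \<cdot>\<^sub>m 1\<^sub>m n"
  proof (rule eq_matI)
    fix i j assume "i < dim_row (c \<cdot>\<^sub>m 1\<^sub>m n)" "j < dim_col (c \<cdot>\<^sub>m 1\<^sub>m n)"
    then have ij: "i < n" "j < n" by auto
    have "unit_vec n j \<in> W" using W by simp
    then have "T *\<^sub>v unit_vec n j = c \<cdot>\<^sub>v unit_vec n j" by (simp add: W_def)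
    then have "(T *\<^sub>v unit_vec n j) $ i = (c \<cdot>\<^sub>v unit_vec n j) $ i" by simp
    then show "T $$ (i,j) = (c \<cdot>\<^sub>m 1\<^sub>m n) $$ (i,j)" using T ij by auto
  qed (use T in auto)
  moreover from this have "mtrace T = c * of_nat n"
    by (simp add: mtrace_smult[of _ n] mtrace_one)
  ultimately show ?thesis using degree_pos by simp
qed

text \<open>First orthogonality: averaging a matrix unit over the group gives a matrix that commutes
  with the representation, so Schur's lemma determines its entries.\<close>

lemma sum_norm_char: "(\<Sum>g\<in>carrier G. (cmod (\<chi> g))\<^sup>2) = real (Coset.order G)"
proof -
  let ?f = "\<lambda>i k l j. \<Sum>g\<in>carrier G. \<rho> g $$ (i,k) * \<rho> (inv g) $$ (l,j)"
  define N :: complex where "N = of_nat (Coset.order G)"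
  have main: "?f k k l l = (if k = l then N / of_nat n else 0)" if kl: "k < n" "l < n" for k l
  proof -
    \<comment> \<open>\<open>P\<close> is the sum of \<open>\<rho> g * E * \<rho> (inv g)\<close>,
      where \<open>E\<close> is the matrix unit at \<open>(k,l)\<close>; the wanted sum is its entry
      at \<open>(k,l)\<close>.\<close>
    define P where "P = mat n n (\<lambda>(i,j). ?f i k l j)"
    have P: "P \<in> carrier_mat n n" by (simp add: P_def)
    have "P * \<rho> h = \<rho> h * P" if h: "h \<in> carrier G" for h
    proof (rule eq_matI)
      fix i j assume "i < dim_row (\<rho> h * P)" "j < dim_col (\<rho> h * P)"
      then have ij: "i < n" "j < n" using h P by auto
      have "(P * \<rho> h) $$ (i,j) = (\<Sum>m<n. ?f i k l m * \<rho> h $$ (m,j))"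
        using ij h by (auto simp: P_def scalar_prod_def lessThan_atLeast0 intro!: sum.cong)
      also have "\<dots> = (\<Sum>g\<in>carrier G. \<rho> g $$ (i,k) * \<rho> (inv g \<otimes> h) $$ (l,j))"
        using ij h kl
        by (simp add: sum_distrib_right sum_distrib_left rho_mult_entry mult.assoc sum.swap[of _ "carrier G"])
      also have "\<dots> = (\<Sum>g\<in>carrier G. \<rho> (h \<otimes> g) $$ (i,k) * \<rho> (inv (h \<otimes> g) \<otimes> h) $$ (l,j))"
        by (rule sum_translate[OF h, symmetric])
      also have "\<dots> = (\<Sum>g\<in>carrier G. \<rho> (h \<otimes> g) $$ (i,k) * \<rho> (inv g) $$ (l,j))"
        using h by (intro sum.cong refl) (simp add: inv_mult_group m_assoc)
      also have "\<dots> = (\<Sum>m<n. \<rho> h $$ (i,m) * ?f m k l j)"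
        using ij h kl
        by (simp add: sum_distrib_right sum_distrib_left rho_mult_entry mult.assoc sum.swap[of _ "carrier G"])
      also have "\<dots> = (\<rho> h * P) $$ (i,j)"
        using ij h by (auto simp: P_def scalar_prod_def lessThan_atLeast0 intro!: sum.cong)
      finally show "(P * \<rho> h) $$ (i,j) = (\<rho> h * P) $$ (i,j)" .
    qed (use h P in auto)
    from schur[OF P this] have "P $$ (k,l) = ((mtrace P / of_nat n) \<cdot>\<^sub>m 1\<^sub>m n) $$ (k,l)" by simp
    then have "?f k k l l = (if k = l then mtrace P / of_nat n else 0)"
      using kl by (simp add: P_def)
    moreover have "mtrace P = N" if "k = l"
    proof -
      \<comment> \<open>Summing over \<open>i\<close> recombines the factors into
        \<open>\<rho> (inv g \<otimes> g)\<close>, the identity matrix.\<close>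
      have "mtrace P = (\<Sum>g\<in>carrier G. \<Sum>i<n. \<rho> g $$ (i,k) * \<rho> (inv g) $$ (l,i))"
        by (subst sum.swap) (simp add: mtrace_def P_def)
      also have "\<dots> = (\<Sum>g\<in>carrier G. \<rho> (inv g \<otimes> g) $$ (l,k))"
        using kl by (intro sum.cong refl, subst rho_mult_entry) (auto simp: mult.commute)
      also have "\<dots> = N" using kl that by (simp add: rho_one N_def Coset.order_def)
      finally show ?thesis .
    qed
    ultimately show ?thesis by simp
  qed
  have "of_real (\<Sum>g\<in>carrier G. (cmod (\<chi> g))\<^sup>2) = (\<Sum>g\<in>carrier G. \<chi> g * \<chi> (inv g))"
    by (simp add: char_inv complex_norm_square del: of_real_power)
  also have "\<dots> = (\<Sum>g\<in>carrier G. \<Sum>k<n. \<Sum>l<n. \<rho> g $$ (k,k) * \<rho> (inv g) $$ (l,l))"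
    by (simp add: mtrace_def sum_product)
  also have "\<dots> = (\<Sum>k<n. \<Sum>l<n. ?f k k l l)"
    by (subst sum.swap, rule sum.cong[OF refl], subst sum.swap, rule refl)
  also have "\<dots> = (\<Sum>k<n. \<Sum>l<n. if k = l then N / of_nat n else 0)"
    using main by (intro sum.cong refl) auto
  also have "\<dots> = N" using degree_pos by simp
  finally show ?thesis unfolding N_def by (metis of_real_eq_iff of_real_of_nat_eq)
qed

text \<open>\<open>T\<close> is a positive multiple of the class sum of \<open>g\<close>, since
  \<open>h\<close> runs over the group and not over the class. Schur's lemma makes it scalar, and
  its trace is 0, so \<open>T\<close> itself is 0.\<close>

lemma sum_char_commutator:
  assumes g: "g \<in> carrier G" and zero: "\<chi> g = 0"
  shows "(\<Sum>h\<in>carrier G. \<chi> (h \<otimes> g \<otimes> inv h \<otimes> inv g)) = 0"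
proof -
  define T where "T = mat n n (\<lambda>(i,j). \<Sum>h\<in>carrier G. \<rho> (h \<otimes> g \<otimes> inv h) $$ (i,j))"
  have T: "T \<in> carrier_mat n n" by (simp add: T_def)
  have "T * \<rho> x = \<rho> x * T" if x: "x \<in> carrier G" for x
  proof (rule eq_matI)
    fix i j assume "i < dim_row (\<rho> x * T)" "j < dim_col (\<rho> x * T)"
    then have ij: "i < n" "j < n" using x T by auto
    have "(T * \<rho> x) $$ (i,j) = (\<Sum>m<n. (\<Sum>h\<in>carrier G. \<rho> (h \<otimes> g \<otimes> inv h) $$ (i,m)) * \<rho> x $$ (m,j))"
      using ij x by (auto simp: T_def scalar_prod_def lessThan_atLeast0 intro!: sum.cong)
    also have "\<dots> = (\<Sum>h\<in>carrier G. \<rho> (h \<otimes> g \<otimes> inv h \<otimes> x) $$ (i,j))"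
      using ij x g by (simp add: sum_distrib_right rho_mult_entry[of _ x] sum.swap[of _ "carrier G"])
    also have "\<dots> = (\<Sum>h\<in>carrier G. \<rho> (x \<otimes> h \<otimes> g \<otimes> inv (x \<otimes> h) \<otimes> x) $$ (i,j))"
      by (rule sum_translate[OF x, symmetric])
    also have "\<dots> = (\<Sum>h\<in>carrier G. \<rho> (x \<otimes> (h \<otimes> g \<otimes> inv h)) $$ (i,j))"
      using x g by (intro sum.cong refl) (simp add: inv_mult_group m_assoc)
    also have "\<dots> = (\<Sum>m<n. \<rho> x $$ (i,m) * (\<Sum>h\<in>carrier G. \<rho> (h \<otimes> g \<otimes> inv h) $$ (m,j)))"
      using ij x g by (simp add: sum_distrib_left rho_mult_entry[of x] sum.swap[of _ "carrier G"])
    also have "\<dots> = (\<rho> x * T) $$ (i,j)"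
      using ij x by (auto simp: T_def scalar_prod_def lessThan_atLeast0 intro!: sum.cong)
    finally show "(T * \<rho> x) $$ (i,j) = (\<rho> x * T) $$ (i,j)" .
  qed (use x T in auto)
  note T_scalar = schur[OF T this]
  have "mtrace T = (\<Sum>h\<in>carrier G. \<chi> (h \<otimes> g \<otimes> inv h))"
    using g by (simp add: mtrace_def T_def) (rule sum.swap)
  also have "\<dots> = 0" using g by (simp add: char_conj zero)
  finally have "mtrace T = 0" .
  then have "T $$ (i,j) = 0" if "i < n" "j < n" for i j
    using that arg_cong[OF T_scalar, of "\<lambda>M. M $$ (i,j)"] by simp
  then have T0: "(\<Sum>h\<in>carrier G. \<rho> (h \<otimes> g \<otimes> inv h) $$ (i,j)) = 0" if "i < n" "j < n" for i j
    using that by (simp add: T_def)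
  have "(\<Sum>h\<in>carrier G. \<chi> (h \<otimes> g \<otimes> inv h \<otimes> inv g)) =
      (\<Sum>h\<in>carrier G. \<Sum>i<n. \<Sum>j<n. \<rho> (h \<otimes> g \<otimes> inv h) $$ (i,j) * \<rho> (inv g) $$ (j,i))"
    using g by (intro sum.cong refl) (simp add: rho_mult[of _ "inv g"] mtrace_mult[of _ n])
  also have "\<dots> = (\<Sum>i<n. \<Sum>j<n. (\<Sum>h\<in>carrier G. \<rho> (h \<otimes> g \<otimes> inv h) $$ (i,j)) * \<rho> (inv g) $$ (j,i))"
    by (subst sum.swap, rule sum.cong[OF refl], subst sum.swap) (simp add: sum_distrib_right)
  also have "\<dots> = 0" by (simp add: T0)
  finally show ?thesis .
qed

text \<open>By Schur's lemma \<open>z\<close> acts as a scalar, which is a root of unity because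
  \<open>z\<close> has finite order.\<close>

lemma norm_char_center:
  assumes "z \<in> center G"
  shows "cmod (\<chi> z) = real n"
proof -
  have z: "z \<in> carrier G" "\<And>g. g \<in> carrier G \<Longrightarrow> z \<otimes> g = g \<otimes> z"
    using assms by (auto simp: center_def)
  define c where "c = \<chi> z / of_nat n"
  have "\<rho> z = c \<cdot>\<^sub>m 1\<^sub>m n"
    unfolding c_def using z by (intro schur) (auto simp flip: rho_mult)
  moreover have "(c \<cdot>\<^sub>m 1\<^sub>m n) ^\<^sub>m k = c ^ k \<cdot>\<^sub>m 1\<^sub>m n" for k
  proof (induction k)
    case (Suc k)
    then have "(c \<cdot>\<^sub>m 1\<^sub>m n) ^\<^sub>m Suc k = c \<cdot>\<^sub>m (c ^ k \<cdot>\<^sub>m 1\<^sub>m n)"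
      by (simp add: mult_smult_distrib[of _ n n _ n])
    also have "\<dots> = c ^ Suc k \<cdot>\<^sub>m 1\<^sub>m n" by (intro eq_matI) auto
    finally show ?case .
  qed (auto intro: eq_matI)
  ultimately have "c ^ Coset.order G \<cdot>\<^sub>m 1\<^sub>m n = 1\<^sub>m n" using rho_pow_order[OF z(1)] by simp
  then have "(c ^ Coset.order G \<cdot>\<^sub>m 1\<^sub>m n) $$ (0,0) = (1\<^sub>m n :: complex mat) $$ (0,0)" by simp
  then have "cmod c ^ Coset.order G = 1 ^ Coset.order G" using degree_pos by (simp flip: norm_power)
  then have "cmod c = 1" using order_pos power_eq_imp_eq_base[of "cmod c" "Coset.order G" 1] by simp
  then show ?thesis using degree_pos by (simp add: c_def norm_divide field_simps)
qed

text \<open>In the norm of \<open>\<chi>\<close> only central elements contribute, each with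
  \<open>n ^ 2\<close>.\<close>

lemma degree_square_of_vanishing:
  assumes "\<And>g. g \<in> carrier G - center G \<Longrightarrow> \<chi> g = 0"
  shows "n ^ 2 * card (center G) = Coset.order G"
proof -
  have sub: "center G \<subseteq> carrier G" by (auto simp: center_def)
  have "real (Coset.order G) = (\<Sum>g\<in>center G. (cmod (\<chi> g))\<^sup>2)"
    unfolding sum_norm_char[symmetric] using assms fin sub by (intro sum.mono_neutral_right) auto
  also have "\<dots> = real (n ^ 2 * card (center G))" by (simp add: norm_char_center)
  finally show ?thesis by (metis of_nat_eq_iff)
qed

end

section \<open>From the abstract notions to matrix representations\<close>

lemma (in group) representation_matrix_rep:
  assumes "finite (carrier G)" "representation G n \<rho>"
  shows "matrix_rep G n \<rho>"
proof -
  interpret M: ring "ring_mat TYPE(complex) n ()" by (rule ring_mat)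
  have hom: "\<rho> \<in> hom G (GL n)" and n: "n > 0" using assms by (auto simp: representation_def)
  \<comment> \<open>\<open>hom\<close> only demands multiplicativity; the identity goes to the
    identity matrix because the target is a group.\<close>
  have "group (GL n)" unfolding GL_def by (rule M.units_group)
  then have one: "\<rho> \<one> = \<one>\<^bsub>GL n\<^esub>" using hom hom_one is_group by blast
  have "\<rho> g \<in> Units (ring_mat TYPE(complex) n ())" if "g \<in> carrier G" for g
    using hom that by (auto simp: hom_def GL_def units_of_def)
  then have car: "\<rho> g \<in> carrier_mat n n" if "g \<in> carrier G" for g
    using that M.Units_closed by (fastforce simp: ring_mat_simps)
  show ?thesis
  proof unfold_locales
    show "\<rho> (g \<otimes> h) = \<rho> g * \<rho> h" if "g \<in> carrier G" "h \<in> carrier G" for g h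
      using hom_mult[OF hom that] by (simp add: GL_def units_of_def ring_mat_simps)
    show "\<rho> \<one> = 1\<^sub>m n" using one by (simp add: GL_def units_of_def ring_mat_simps)
  qed (use assms n car in auto)
qed

lemma (in group) characters_matrix_rep:
  assumes "finite (carrier G)" "\<chi> \<in> characters G"
  obtains n \<rho> where "matrix_rep G n \<rho>" "\<And>g. g \<in> carrier G \<Longrightarrow> \<chi> g = mtrace (\<rho> g)"
  using assms representation_matrix_rep unfolding characters_def afforded_def by fastforce

lemma (in group) Irr_matrix_rep:
  assumes "finite (carrier G)" "\<chi> \<in> Irr G"
  obtains n \<rho> where "irreducible_matrix_rep G n \<rho>" "\<And>g. g \<in> carrier G \<Longrightarrow> \<chi> g = mtrace (\<rho> g)"
proof -
  obtain n \<rho> where *: "irreducible_representation G n \<rho>" "\<chi> = afforded G \<rho>"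
    using assms(2) unfolding Irr_def by blast
  then have "irreducible_matrix_rep G n \<rho>"
    using representation_matrix_rep[OF assms(1)]
    by (auto simp: irreducible_matrix_rep_def irreducible_matrix_rep_axioms_def irreducible_representation_def)
  with that * show ?thesis by (simp add: afforded_def)
qed

section \<open>Elements acting as scalars\<close>

context matrix_rep
begin

lemma char_scalar_mult:
  assumes "z \<in> carrier G" "g \<in> carrier G" "cmod (\<chi> z) = real n"
  shows "\<chi> (z \<otimes> g) = \<chi> z / of_nat n * \<chi> g"
proof -
  have "\<rho> (z \<otimes> g) = (\<chi> z / of_nat n) \<cdot>\<^sub>m (1\<^sub>m n * \<rho> g)"
    using assms rho_scalar[OF assms(1,3)] by (metis rho_mult mult_smult_assoc_mat closed one_carrier_mat)
  then show ?thesis using assms by (simp add: mtrace_smult[of _ n])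
qed

text \<open>The representing matrix is scalar, so every commutator with \<open>z\<close> lies in the kernel.\<close>
lemma faithful_imp_center:
  assumes faithful: "\<And>g. g \<in> carrier G \<Longrightarrow> \<chi> g = of_nat n \<Longrightarrow> g = \<one>"
    and z: "z \<in> carrier G" "cmod (\<chi> z) = real n"
  shows "z \<in> center G"
  unfolding center_def
proof (intro CollectI conjI ballI z(1))
  fix g assume g: "g \<in> carrier G"
  have "\<chi> (z \<otimes> (g \<otimes> inv z \<otimes> inv g)) = \<chi> z / of_nat n * \<chi> (inv z)"
    using z g by (simp add: char_scalar_mult char_conj)
  also have "\<dots> = of_nat n"
    using z degree_pos
    by (simp add: char_inv complex_norm_square[symmetric] power2_eq_square del: of_real_power)
  finally have "z \<otimes> (g \<otimes> inv z \<otimes> inv g) = \<one>" using faithful z g by simp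
  then have "z \<otimes> g \<otimes> inv (g \<otimes> z) = \<one>"
    using z g by (simp add: inv_mult_group m_assoc)
  then show "z \<otimes> g = g \<otimes> z" using z g by (metis inv_closed inv_equality inv_inv m_closed)
qed

end

theorem theoremD:
  fixes G :: "('a, 'b) monoid_scheme" (structure)
    and \<phi> \<psi> \<Delta> :: "'a \<Rightarrow> complex"
    and m :: nat
  assumes "group G" and "finite (carrier G)"
    and "\<phi> \<in> characters G" and "faithful G \<phi>"
    and "\<psi> \<in> Irr G"
    and "\<Delta> \<in> characters G"
    and "m > 0"
    and "\<forall>g\<in>carrier G. \<phi> g * \<psi> g = of_nat m * \<Delta> g"
    and "Re (\<Delta> \<one>) \<le> Re (\<psi> \<one>)"
  shows "(\<forall>g\<in>carrier G - center G. \<phi> g = 0 \<and> \<psi> g = 0 \<and> \<Delta> g = 0) \<and>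
         (\<phi> \<in> Irr G \<longrightarrow> \<phi> \<one> = \<psi> \<one> \<and> \<psi> \<one> = \<Delta> \<one>)"
proof -
  interpret group G by fact
  note fin = \<open>finite (carrier G)\<close>
  obtain a \<sigma> where \<sigma>: "matrix_rep G a \<sigma>" "\<And>g. g \<in> carrier G \<Longrightarrow> \<phi> g = mtrace (\<sigma> g)"
    using characters_matrix_rep[OF fin \<open>\<phi> \<in> characters G\<close>] by blast
  obtain b \<tau> where \<tau>: "irreducible_matrix_rep G b \<tau>" "\<And>g. g \<in> carrier G \<Longrightarrow> \<psi> g = mtrace (\<tau> g)"
    using Irr_matrix_rep[OF fin \<open>\<psi> \<in> Irr G\<close>] by blast
  obtain d \<delta> where \<delta>: "matrix_rep G d \<delta>" "\<And>g. g \<in> carrier G \<Longrightarrow> \<Delta> g = mtrace (\<delta> g)"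
    using characters_matrix_rep[OF fin \<open>\<Delta> \<in> characters G\<close>] by blast
  interpret A: matrix_rep G a \<sigma> by (rule \<sigma>(1))
  interpret B: irreducible_matrix_rep G b \<tau> by (rule \<tau>(1))
  interpret D: matrix_rep G d \<delta> by (rule \<delta>(1))
  have one: "\<phi> \<one> = of_nat a" "\<psi> \<one> = of_nat b" "\<Delta> \<one> = of_nat d"
    using \<sigma>(2) \<tau>(2) \<delta>(2) A.char_one B.char_one D.char_one by auto
  have prod: "\<phi> g * \<psi> g = of_nat m * \<Delta> g" if "g \<in> carrier G" for g
    using assms(8) that by blast
  have "of_nat (a * b) = (of_nat (m * d) :: complex)"
    using prod[of \<one>] by (simp add: one)
  then have ab: "a * b = m * d" by (simp only: of_nat_eq_iff)
  have db: "d \<le> b" using assms(9) by (simp add: one)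
  have "a * b \<le> m * b" using ab db by simp
  then have am: "a \<le> m" using B.degree_pos by simp

  \<comment> \<open>Up to the factor \<open>Coset.order G\<close>, \<open>S\<close> is the gap in
    \<open>[\<phi>\<psi>,\<phi>\<psi>] \<le> \<phi>(1)^2 [\<psi>,\<psi>]\<close>, written as a sum
    of nonnegative terms.\<close>
  define S where "S = (\<Sum>g\<in>carrier G. ((real a)\<^sup>2 - (cmod (\<phi> g))\<^sup>2) * (cmod (\<psi> g))\<^sup>2)"
  have nonneg: "((real a)\<^sup>2 - (cmod (\<phi> g))\<^sup>2) * (cmod (\<psi> g))\<^sup>2 \<ge> 0" if "g \<in> carrier G" for g
    using A.norm_char_le[OF that] \<sigma>(2)[OF that] by simp
  have \<psi>_norm: "(\<Sum>g\<in>carrier G. (cmod (\<psi> g))\<^sup>2) = real (Coset.order G)"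
    using B.sum_norm_char \<tau>(2) by simp
  have \<Delta>_norm: "(\<Sum>g\<in>carrier G. (cmod (\<Delta> g))\<^sup>2) \<ge> real (Coset.order G)"
    using D.sum_norm_char_ge \<delta>(2) by simp
  have "(cmod (\<phi> g))\<^sup>2 * (cmod (\<psi> g))\<^sup>2 = (real m)\<^sup>2 * (cmod (\<Delta> g))\<^sup>2" if "g \<in> carrier G" for g
    using arg_cong[OF prod[OF that], of cmod] by (simp add: norm_mult flip: power_mult_distrib)
  then have S: "S = (real a)\<^sup>2 * real (Coset.order G) - (real m)\<^sup>2 * (\<Sum>g\<in>carrier G. (cmod (\<Delta> g))\<^sup>2)"
    unfolding S_def \<psi>_norm[symmetric] by (simp add: left_diff_distrib sum_subtractf sum_distrib_left)
  have "S \<ge> 0" unfolding S_def using nonneg by (rule sum_nonneg)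
  have S_le: "S \<le> ((real a)\<^sup>2 - (real m)\<^sup>2) * real (Coset.order G)"
    unfolding S using mult_left_mono[OF \<Delta>_norm, of "(real m)\<^sup>2"] by (simp add: algebra_simps)
  also have "\<dots> \<le> 0" using am by (intro mult_nonpos_nonneg) auto
  finally have "S = 0" using \<open>S \<ge> 0\<close> by simp
  then have zero: "\<forall>g\<in>carrier G. ((real a)\<^sup>2 - (cmod (\<phi> g))\<^sup>2) * (cmod (\<psi> g))\<^sup>2 = 0"
    using nonneg fin unfolding S_def by (simp only: sum_nonneg_eq_0_iff)
  have \<phi>_norm: "cmod (mtrace (\<sigma> g)) = real a" if "g \<in> carrier G" "\<psi> g \<noteq> 0" for g
    using that bspec[OF zero that(1)] \<sigma>(2)[OF that(1)] by simp
  \<comment> \<open>The bound \<open>S_le\<close> serves twice: with \<open>a \<le> m\<close> it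
    gave \<open>S = 0\<close>, and now \<open>S = 0\<close> yields the converse inequality.\<close>
  have "(real m)\<^sup>2 \<le> (real a)\<^sup>2"
  proof -
    have "0 \<le> ((real a)\<^sup>2 - (real m)\<^sup>2) * real (Coset.order G)" using S_le \<open>S = 0\<close> by simp
    then show ?thesis using A.order_pos by (simp add: zero_le_mult_iff)
  qed
  then have "m \<le> a" by simp
  with am have ma: "a = m" by simp
  then have bd: "b = d" using ab \<open>m > 0\<close> by simp

  have faithful: "g = \<one>" if "g \<in> carrier G" "mtrace (\<sigma> g) = of_nat a" for g
    using \<open>faithful G \<phi>\<close> that \<sigma>(2) one unfolding faithful_def char_kernel_def by auto
  have \<psi>0: "\<psi> g = 0" if "g \<in> carrier G - center G" for g
    using that A.faithful_imp_center[OF faithful] \<phi>_norm by blast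
  have \<phi>0: "\<phi> g = 0" if g: "g \<in> carrier G - center G" for g
  proof -
    let ?c = "\<lambda>h. h \<otimes> g \<otimes> inv h \<otimes> inv g"
    have gG: "g \<in> carrier G" using g by simp
    \<comment> \<open>Otherwise only those \<open>h\<close> that commute with \<open>g\<close>
      contribute to the vanishing commutator sum, each with \<open>\<psi> \<one>\<close>; as
      \<open>\<one>\<close> is among them, the sum would be positive.\<close>
    have "\<exists>h\<in>carrier G. ?c h \<noteq> \<one> \<and> \<psi> (?c h) \<noteq> 0"
    proof (rule ccontr)
      assume neg: "\<not> ?thesis"
      define C where "C = {h \<in> carrier G. ?c h = \<one>}"
      have "0 = (\<Sum>h\<in>carrier G. \<psi> (?c h))"
        using B.sum_char_commutator[OF gG] \<psi>0[OF g] \<tau>(2) gG by simp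
      also have "\<dots> = (\<Sum>h\<in>C. \<psi> (?c h))"
        using neg fin by (intro sum.mono_neutral_right) (auto simp: C_def)
      also have "\<dots> = of_nat (card C * b)" by (simp add: C_def one)
      finally have "card C * b = 0" by (metis of_nat_eq_0_iff)
      moreover have "\<one> \<in> C" "finite C" using gG fin by (auto simp: C_def)
      ultimately show False using B.degree_pos by auto
    qed
    then obtain h where h: "h \<in> carrier G" "?c h \<noteq> \<one>" "\<psi> (?c h) \<noteq> 0" by blast
    have cG: "?c h \<in> carrier G" using h gG by simp
    \<comment> \<open>The commutator acts as a scalar and carries \<open>g\<close> to a conjugate,
      so \<open>\<phi> g\<close> is fixed by a scalar that differs from 1 by faithfulness.\<close>
    have "?c h \<otimes> g = h \<otimes> g \<otimes> inv h" using h gG by (simp add: m_assoc)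
    then have "mtrace (\<sigma> g) = mtrace (\<sigma> (?c h)) / of_nat a * mtrace (\<sigma> g)"
      using A.char_scalar_mult[OF cG gG \<phi>_norm[OF cG h(3)]] A.char_conj[OF gG h(1)] by simp
    moreover have "mtrace (\<sigma> (?c h)) \<noteq> of_nat a" using faithful[OF cG] h by blast
    ultimately have "mtrace (\<sigma> g) = 0" using A.degree_pos by (auto simp: field_simps)
    then show ?thesis using \<sigma>(2)[OF gG] by simp
  qed
  have \<Delta>0: "\<Delta> g = 0" if "g \<in> carrier G - center G" for g
    using prod[of g] \<psi>0[OF that] that \<open>m > 0\<close> by simp
  have "\<phi> \<one> = \<psi> \<one> \<and> \<psi> \<one> = \<Delta> \<one>" if irr: "\<phi> \<in> Irr G"
  proof -
    \<comment> \<open>\<open>\<sigma>\<close> came only from \<open>\<phi>\<close> being a character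
      and is not known to be irreducible, so an irreducible representation affording
      \<open>\<phi>\<close> is chosen afresh.\<close>
    obtain a' \<sigma>' where \<sigma>': "irreducible_matrix_rep G a' \<sigma>'" "\<And>g. g \<in> carrier G \<Longrightarrow> \<phi> g = mtrace (\<sigma>' g)"
      using Irr_matrix_rep[OF fin irr] by blast
    interpret A': irreducible_matrix_rep G a' \<sigma>' by (rule \<sigma>'(1))
    have "a'\<^sup>2 * card (center G) = Coset.order G"
      using \<phi>0 \<sigma>'(2) by (intro A'.degree_square_of_vanishing) auto
    also have "\<dots> = b\<^sup>2 * card (center G)"
      using \<psi>0 \<tau>(2) by (intro B.degree_square_of_vanishing[symmetric]) auto
    finally have "a'\<^sup>2 * card (center G) = b\<^sup>2 * card (center G)" .
    \<comment> \<open>If this were 0, the degree formula would give group order 0.\<close>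
    moreover have "card (center G) \<noteq> 0"
      using A'.degree_square_of_vanishing \<phi>0 \<sigma>'(2) A.order_pos by (metis DiffE mult_0_right less_irrefl)
    ultimately have "a' = b" by simp
    moreover have "\<phi> \<one> = of_nat a'" using \<sigma>'(2) A'.char_one by simp
    ultimately show ?thesis by (simp add: one bd)
  qed
  with \<phi>0 \<psi>0 \<Delta>0 show ?thesis by blast
qed

end
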